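(* The solutions of the equation $$\left\langle\begin{pmatrix}0&1\\0&0\end{pmatrix}Y+\begin{pmatrix}0\\1\end{pmatrix},N_Y\right\rangle=k_Y^{1/3}$$ for curves $Y$ in $\mathbb{R}^2$ are the following curves: (1) The parabolas $x=\frac12y^2-y+C$, with $C$ any constant. (2) The curves given in the following parametrized form, with $C_1$, $C_2$ any constants: $$x(w)=\begin{cases}\displaystyle\int_w^{\infty}\frac{y_+(\xi)}{\xi^3-1}\,d\xi+(C_1-1)y_+(w)+\frac{2}{\sqrt3}\arctan\left(\frac{2w+1}{\sqrt3}\right)-\frac{\pi}{\sqrt3}+C_2,&1<w\le\infty,\\[2mm] \displaystyle\int_{-\infty}^{w}\frac{y_-(\xi)}{1-\xi^3}\,d\xi+(C_1-1)y_-(w)+\frac{2}{\sqrt3}\arctan\left(\frac{2w+1}{\sqrt3}\right)+\frac{\pi}{\sqrt3}+C_2,&w<1,\end{cases}$$ and $$y(w)=\begin{cases}y_+(w)+C_1,&1<w\le\infty,\\ y_-(w)+C_1,&w<1,\end{cases}$$ where $$y_+(w)=-\frac13\ln(w-1)+\frac16\ln(1+w+w^2)+\frac1{\sqrt3}\arctan\left(\frac{2w+1}{\sqrt3}\right)-\frac{\pi}{2\sqrt3}\quad(w>1),$$ $$y_-(w)=-\frac13\ln(1-w)+\frac16\ln(1+w+w^2)+\frac1{\sqrt3}\arctan\left(\frac{2w+1}{\sqrt3}\right)+\frac{\pi}{2\sqrt3}\quad(w<1).$$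
   Context: Points of $\mathbb{R}^2$ are written as $(x,y)$. Curves are smooth immersed curves. For a curve $Y=Y(u)$, put $T=Y_u/\|Y_u\|$, $N_Y=JT$ with $J=\begin{pmatrix}0&-1\\1&0\end{pmatrix}$ (unit normal), and $k_Y=\det(Y_u,Y_{uu})/\|Y_u\|^3$ (curvature with respect to $N_Y$). $\langle\cdot,\cdot\rangle$ is the Euclidean inner product and $k^{1/3}$ is the real (odd) cube root. Solutions are regarded as geometric curves (up to reparametrization), connected and maximally extended. In (2), values at $w=\infty$ are limits as $w\to+\infty$, and $w=+\infty$ is identified with $w=-\infty$: the two arcs $w>1$ and $w<1$ are joined at the parameter value $w=\pm\infty$ into one curve. *)

theory Defs
  imports "HOL-Analysis.Analysis"
begin

definition smooth_on :: "real set \<Rightarrow> (real \<Rightarrow> 'a::real_normed_vector) \<Rightarrow> bool" where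
  "smooth_on I f \<longleftrightarrow>
     (\<forall>n. \<forall>u\<in>I. ((\<lambda>g v. vector_derivative g (at v)) ^^ n) f differentiable (at u))"

definition velocity :: "(real \<Rightarrow> real^2) \<Rightarrow> real \<Rightarrow> real^2" where
  "velocity Y u = vector_derivative Y (at u)"

definition acceleration :: "(real \<Rightarrow> real^2) \<Rightarrow> real \<Rightarrow> real^2" where
  "acceleration Y u = vector_derivative (velocity Y) (at u)"

text \<open>
  A curve is a map together with its parameter interval; its values outside the interval carry no
  meaning. Closed curves appear as periodic maps on the whole line.
\<close>

definition immersed_curve :: "real set \<Rightarrow> (real \<Rightarrow> real^2) \<Rightarrow> bool" where
  "immersed_curve I Y \<longleftrightarrow>
     open I \<and> is_interval I \<and> I \<noteq> {} \<and> smooth_on I Y \<and> (\<forall>u\<in>I. velocity Y u \<noteq> 0)"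

definition unit_tangent :: "(real \<Rightarrow> real^2) \<Rightarrow> real \<Rightarrow> real^2" where
  "unit_tangent Y u = velocity Y u /\<^sub>R norm (velocity Y u)"

definition rotJ :: "real^2^2" where
  "rotJ = vector [vector [0, -1], vector [1, 0]]"

definition unit_normal :: "(real \<Rightarrow> real^2) \<Rightarrow> real \<Rightarrow> real^2" where
  "unit_normal Y u = rotJ *v unit_tangent Y u"

text \<open>The transpose turns the two vectors into the columns of the matrix.\<close>

definition curvature :: "(real \<Rightarrow> real^2) \<Rightarrow> real \<Rightarrow> real" where
  "curvature Y u =
     det (transpose (vector [velocity Y u, acceleration Y u])) / norm (velocity Y u) ^ 3"

definition reparam_into ::
    "(real \<Rightarrow> real) \<Rightarrow> real set \<Rightarrow> (real \<Rightarrow> real^2) \<Rightarrow> real set \<Rightarrow> (real \<Rightarrow> real^2) \<Rightarrow> bool" where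
  "reparam_into \<phi> I Y K Z \<longleftrightarrow>
     smooth_on I \<phi> \<and> (\<forall>u\<in>I. deriv \<phi> u \<noteq> 0) \<and> \<phi> ` I \<subseteq> K \<and> (\<forall>u\<in>I. Y u = Z (\<phi> u))"

text \<open>Equality of geometric curves; reversal of the orientation is allowed.\<close>

definition same_curve ::
    "real set \<Rightarrow> (real \<Rightarrow> real^2) \<Rightarrow> real set \<Rightarrow> (real \<Rightarrow> real^2) \<Rightarrow> bool" where
  "same_curve I Y K Z \<longleftrightarrow> (\<exists>\<phi>. reparam_into \<phi> I Y K Z \<and> bij_betw \<phi> I K)"

definition solution :: "real set \<Rightarrow> (real \<Rightarrow> real^2) \<Rightarrow> bool" where
  "solution I Y \<longleftrightarrow> immersed_curve I Y \<and>
     (\<forall>u\<in>I. ((vector [vector [0, 1], vector [0, 0]] :: real^2^2) *v Y u + vector [0, 1])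
               \<bullet> unit_normal Y u = root 3 (curvature Y u))"

text \<open>A solution is maximally extended if it is not a proper part of another solution.\<close>

definition maximal_solution :: "real set \<Rightarrow> (real \<Rightarrow> real^2) \<Rightarrow> bool" where
  "maximal_solution I Y \<longleftrightarrow> solution I Y \<and>
     (\<forall>K Z \<phi>. solution K Z \<and> reparam_into \<phi> I Y K Z \<longrightarrow> \<phi> ` I = K)"

definition parabola :: "real \<Rightarrow> real \<Rightarrow> real^2" where
  "parabola C v = vector [v\<^sup>2 / 2 - v + C, v]"

definition y_plus :: "real \<Rightarrow> real" where
  "y_plus w = - (1/3) * ln (w - 1) + (1/6) * ln (1 + w + w\<^sup>2)
     + (1 / sqrt 3) * arctan ((2*w + 1) / sqrt 3) - pi / (2 * sqrt 3)"

definition y_minus :: "real \<Rightarrow> real" where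
  "y_minus w = - (1/3) * ln (1 - w) + (1/6) * ln (1 + w + w\<^sup>2)
     + (1 / sqrt 3) * arctan ((2*w + 1) / sqrt 3) + pi / (2 * sqrt 3)"

text \<open>The coordinates at finite \<open>w \<noteq> 1\<close>; the value at \<open>w = 1\<close> is never used.\<close>

definition x_coord :: "real \<Rightarrow> real \<Rightarrow> real \<Rightarrow> real" where
  "x_coord C1 C2 w =
     (if w > 1
      then integral {w..} (\<lambda>\<xi>. y_plus \<xi> / (\<xi>^3 - 1)) + (C1 - 1) * y_plus w
             + (2 / sqrt 3) * arctan ((2*w + 1) / sqrt 3) - pi / sqrt 3 + C2
      else integral {..w} (\<lambda>\<xi>. y_minus \<xi> / (1 - \<xi>^3)) + (C1 - 1) * y_minus w
             + (2 / sqrt 3) * arctan ((2*w + 1) / sqrt 3) + pi / sqrt 3 + C2)"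

definition y_coord :: "real \<Rightarrow> real \<Rightarrow> real" where
  "y_coord C1 w = (if w > 1 then y_plus w + C1 else y_minus w + C1)"

text \<open>
  The two arcs \<open>w > 1\<close> and \<open>w < 1\<close>, joined at \<open>w = \<plusminus>\<infinity>\<close>. The parameter \<open>w\<close> runs through the projective
  line without the point \<open>1\<close>, which the projective coordinate \<open>t = 1 / (1 - w)\<close>, that is
  \<open>w = 1 - 1 / t\<close>, identifies with the real line: \<open>t < 0\<close> corresponds to \<open>1 < w < \<infinity>\<close>, \<open>t = 0\<close> to
  \<open>w = \<plusminus>\<infinity>\<close>, and \<open>t > 0\<close> to \<open>w < 1\<close>.
\<close>

definition joined_curve :: "real \<Rightarrow> real \<Rightarrow> real \<Rightarrow> real^2" where
  "joined_curve C1 C2 t =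
     (if t = 0 then vector [Lim at_top (x_coord C1 C2), Lim at_top (y_coord C1)]
      else vector [x_coord C1 C2 (1 - 1 / t), y_coord C1 (1 - 1 / t)])"

end

theory Submission
  imports Defs "HOL-Real_Asymp.Real_Asymp"
begin

text \<open>
  Put \<open>\<sigma> = x - y^2 / 2 + y\<close>, and write \<open>a\<close> and \<open>q\<close> for the derivatives of \<open>\<sigma>\<close> and \<open>y\<close> along a curve.
  Multiplied by the speed and cubed, the equation becomes
  \<open>a q' - q a' = a (a^2 - 3 a q + 3 q^2)\<close>, see \<open>solution_unshear_iff\<close>. Neither \<open>\<sigma>\<close> nor \<open>y\<close> itself
  occurs: the shear has turned the equation into one that is invariant under all translations of the
  \<open>(\<sigma>, y)\<close> plane, and those translations become the constants \<open>C\<close>, \<open>C1\<close>, \<open>C2\<close>.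

  The factor \<open>a\<close> on the right splits the solutions into two classes. Near a zero of \<open>a\<close> the function
  \<open>q\<close> does not vanish and \<open>a\<close> solves a homogeneous linear equation, so \<open>a\<close> vanishes everywhere or
  nowhere (\<open>sheared_solution_dichotomy\<close>). If \<open>a\<close> vanishes everywhere, then \<open>\<sigma>\<close> is constant, which is
  a parabola parametrized by \<open>y\<close>. If \<open>a\<close> vanishes nowhere, the slope \<open>t = q / a\<close> satisfies
  \<open>t' = a D\<close> with \<open>D = 3 t^2 - 3 t + 1 > 0\<close>. Hence \<open>t\<close> is a regular parameter, with respect to
  which \<open>\<sigma>\<close> and \<open>y\<close> have the derivatives \<open>1 / D\<close> and \<open>t / D\<close>; two integrations determine the curve up
  to two constants (\<open>sheared_solution_joined\<close>).

  This parameter is the projective coordinate \<open>t = 1 / (1 - w)\<close> of the joined curve, and the joined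
  curve has exactly these two derivatives: the integrals in its first coordinate equal \<open>y_plus^2 / 2\<close>
  and \<open>y_minus^2 / 2\<close>, and the jump of the arctangent at \<open>w = \<plusminus>\<infinity>\<close> is absorbed by the constants
  containing \<open>pi\<close> (\<open>joined_curve_closed_form\<close>). In particular the two arcs fit together smoothly at
  \<open>t = 0\<close>.

  Both families are maximal because their parameters, \<open>y\<close> for parabolas and \<open>t\<close> for joined curves,
  are defined on every larger solution (by the dichotomy), are injective there, and already take all
  real values on the given curve
  (\<open>image_eq_if_left_inverse\<close>).
\<close>

section \<open>Smooth functions of one real variable\<close>

text \<open>
  The iterated derivative in the definition of smoothness is awkward in proofs, because it speaks of
  \<^const>\<open>vector_derivative\<close> also at points where nothing is known. Here any function that
  happens to be the derivative on \<open>I\<close> may be used, so that the calculus rules follow by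
  induction on the order.
\<close>

fun differentiable_times :: "nat \<Rightarrow> real set \<Rightarrow> (real \<Rightarrow> 'a::real_normed_vector) \<Rightarrow> bool" where
  "differentiable_times 0 I f \<longleftrightarrow> True"
| "differentiable_times (Suc n) I f \<longleftrightarrow>
     (\<exists>f'. (\<forall>u\<in>I. (f has_vector_derivative f' u) (at u)) \<and> differentiable_times n I f')"

lemma differentiable_times_cong:
  assumes "open I" "\<And>u. u \<in> I \<Longrightarrow> f u = g u" "differentiable_times n I f"
  shows "differentiable_times n I g"
proof (cases n)
  case (Suc m)
  then obtain f' where f': "\<forall>u\<in>I. (f has_vector_derivative f' u) (at u)"
    "differentiable_times m I f'" using assms(3) by auto
  have "\<forall>u\<in>I. (g has_vector_derivative f' u) (at u)"
    using f'(1) assms(1,2) has_vector_derivative_transform_within_open by blast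
  then show ?thesis using Suc f'(2) by auto
qed simp

lemma differentiable_times_mono_Suc:
  "differentiable_times (Suc n) I f \<Longrightarrow> differentiable_times n I f"
proof (induction n arbitrary: f)
  case (Suc n)
  then obtain f' where "\<forall>u\<in>I. (f has_vector_derivative f' u) (at u)"
    "differentiable_times (Suc n) I f'"
    by (subst (asm) (2) differentiable_times.simps(2)) blast
  then show ?case using Suc.IH by auto
qed simp

lemma smooth_on_has_vector_derivative:
  assumes "smooth_on I f" "u \<in> I"
  shows "(f has_vector_derivative vector_derivative f (at u)) (at u)"
proof -
  have "((\<lambda>g v. vector_derivative g (at v)) ^^ 0) f differentiable at u"
    using assms unfolding smooth_on_def by blast
  then show ?thesis by (simp add: vector_derivative_works)
qed

lemma smooth_on_vector_derivative:
  assumes "smooth_on I f"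
  shows "smooth_on I (\<lambda>u. vector_derivative f (at u))"
  unfolding smooth_on_def
proof (intro allI ballI)
  fix k u assume "u \<in> I"
  then have "((\<lambda>g v. vector_derivative g (at v)) ^^ Suc k) f differentiable at u"
    using assms unfolding smooth_on_def by blast
  then show "((\<lambda>g v. vector_derivative g (at v)) ^^ k) (\<lambda>u. vector_derivative f (at u))
    differentiable at u"
    by (simp only: funpow_Suc_right o_apply)
qed

lemma differentiable_times_if_smooth_on: "smooth_on I f \<Longrightarrow> differentiable_times n I f"
proof (induction n arbitrary: f)
  case (Suc n)
  show ?case
    unfolding differentiable_times.simps(2)
  proof (intro exI conjI ballI)
    show "(f has_vector_derivative vector_derivative f (at u)) (at u)" if "u \<in> I" for u
      using Suc.prems that by (rule smooth_on_has_vector_derivative)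
    show "differentiable_times n I (\<lambda>u. vector_derivative f (at u))"
      using Suc.prems by (intro Suc.IH smooth_on_vector_derivative)
  qed
qed simp

lemma funpow_vector_derivative_differentiable:
  assumes "open I" "differentiable_times (Suc n) I f" "u \<in> I"
  shows "((\<lambda>g v. vector_derivative g (at v)) ^^ n) f differentiable (at u)"
  using assms(2)
proof (induction n arbitrary: f)
  case 0
  then show ?case using assms(3) by (auto simp: differentiableI_vector)
next
  case (Suc n)
  let ?D = "\<lambda>g v. vector_derivative g (at v)"
  obtain f' where f': "\<forall>u\<in>I. (f has_vector_derivative f' u) (at u)"
    "differentiable_times (Suc n) I f'"
    using Suc.prems by (subst (asm) differentiable_times.simps(2)) blast
  have "differentiable_times (Suc n) I (?D f)"
  proof (rule differentiable_times_cong[OF assms(1) _ f'(2)])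
    show "f' u = vector_derivative f (at u)" if "u \<in> I" for u
      using vector_derivative_at[OF f'(1)[rule_format, OF that]] by (rule sym)
  qed
  then have "(?D ^^ n) (?D f) differentiable at u" by (rule Suc.IH)
  then show ?case by (simp only: funpow_Suc_right o_apply)
qed

lemma smooth_on_iff_differentiable_times:
  "open I \<Longrightarrow> smooth_on I f \<longleftrightarrow> (\<forall>n. differentiable_times n I f)"
  using differentiable_times_if_smooth_on[of I f] funpow_vector_derivative_differentiable[of I _ f]
  unfolding smooth_on_def by blast

lemma smooth_on_antiderivative:
  assumes "open I" "\<And>u. u \<in> I \<Longrightarrow> (f has_vector_derivative f' u) (at u)" "smooth_on I f'"
  shows "smooth_on I f"
proof -
  have "differentiable_times n I f" for n
  proof (cases n)
    case (Suc m)
    then show ?thesis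
      using assms(2) differentiable_times_if_smooth_on[OF assms(3)] by auto
  qed simp
  then show ?thesis using smooth_on_iff_differentiable_times[OF assms(1)] by blast
qed

lemma smooth_on_const: "smooth_on I (\<lambda>u. c)"
proof -
  have "((\<lambda>g v. vector_derivative g (at v)) ^^ n) (\<lambda>u::real. c) = (\<lambda>u. if n = 0 then c else 0)" for n
    by (induction n) auto
  then show ?thesis unfolding smooth_on_def by simp
qed

lemma smooth_on_ident: "open I \<Longrightarrow> smooth_on I (\<lambda>u. u)"
  by (rule smooth_on_antiderivative[where f' = "\<lambda>u. 1"]) (auto intro: smooth_on_const)

lemma differentiable_times_linear:
  assumes "bounded_linear h"
  shows "differentiable_times n I f \<Longrightarrow> differentiable_times n I (\<lambda>u. h (f u))"
proof (induction n arbitrary: f)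
  case (Suc n)
  then obtain f' where f': "\<forall>u\<in>I. (f has_vector_derivative f' u) (at u)"
    "differentiable_times n I f'" by auto
  then have "\<forall>u\<in>I. ((\<lambda>u. h (f u)) has_vector_derivative h (f' u)) (at u)"
    using bounded_linear.has_vector_derivative[OF assms] by blast
  then show ?case using Suc.IH[OF f'(2)] by auto
qed simp

lemma differentiable_times_add:
  "differentiable_times n I f \<Longrightarrow> differentiable_times n I g \<Longrightarrow>
   differentiable_times n I (\<lambda>u. f u + g u)"
proof (induction n arbitrary: f g)
  case (Suc n)
  then obtain f' g' where "\<forall>u\<in>I. (f has_vector_derivative f' u) (at u)"
    "\<forall>u\<in>I. (g has_vector_derivative g' u) (at u)"
    and *: "differentiable_times n I f'" "differentiable_times n I g'" by auto
  then have "\<forall>u\<in>I. ((\<lambda>u. f u + g u) has_vector_derivative (f' u + g' u)) (at u)"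
    using has_vector_derivative_add by blast
  then show ?case using Suc.IH[OF *] by auto
qed simp

lemma differentiable_times_mult:
  fixes f g :: "real \<Rightarrow> real"
  shows "differentiable_times n I f \<Longrightarrow> differentiable_times n I g \<Longrightarrow>
    differentiable_times n I (\<lambda>u. f u * g u)"
proof (induction n arbitrary: f g)
  case (Suc n)
  then obtain f' g' where d: "\<forall>u\<in>I. (f has_vector_derivative f' u) (at u)"
    "\<forall>u\<in>I. (g has_vector_derivative g' u) (at u)"
    and *: "differentiable_times n I f'" "differentiable_times n I g'" by auto
  have "\<forall>u\<in>I. ((\<lambda>u. f u * g u) has_vector_derivative (f u * g' u + f' u * g u)) (at u)"
    using d by (auto intro: has_vector_derivative_mult)
  moreover have "differentiable_times n I (\<lambda>u. f u * g' u + f' u * g u)"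
    using * Suc.prems[THEN differentiable_times_mono_Suc]
    by (intro differentiable_times_add Suc.IH)
  ultimately show ?case by auto
qed simp

text \<open>
  The derivative of \<open>1 / f\<close> contains \<open>1 / f\<close> again, but only to the lower order that the induction
  hypothesis provides.
\<close>

lemma differentiable_times_inverse:
  fixes f :: "real \<Rightarrow> real"
  assumes "\<And>u. u \<in> I \<Longrightarrow> f u \<noteq> 0"
  shows "differentiable_times n I f \<Longrightarrow> differentiable_times n I (\<lambda>u. inverse (f u))"
proof (induction n)
  case (Suc n)
  then obtain f' where d: "\<forall>u\<in>I. (f has_vector_derivative f' u) (at u)"
    and *: "differentiable_times n I f'" by auto
  let ?r = "\<lambda>u. inverse (f u)"
  have "(?r has_vector_derivative - 1 * (?r u * f' u * ?r u)) (at u)" if "u \<in> I" for u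
    using DERIV_inverse'[OF d[rule_format, OF that,
          folded has_real_derivative_iff_has_vector_derivative] assms[OF that]]
    by (simp add: has_real_derivative_iff_has_vector_derivative)
  moreover have "differentiable_times n I (\<lambda>u. - 1 * (?r u * f' u * ?r u))"
    using Suc.IH[OF differentiable_times_mono_Suc[OF Suc.prems]] *
    by (intro differentiable_times_linear[OF bounded_linear_mult_right] differentiable_times_mult)
  ultimately show ?case
    unfolding differentiable_times.simps(2)
    by (intro exI[of _ "\<lambda>u. - 1 * (?r u * f' u * ?r u)"] conjI ballI)
qed simp

context
  fixes I :: "real set"
  assumes I: "open I"
begin

lemma smooth_on_linear:
  "bounded_linear h \<Longrightarrow> smooth_on I f \<Longrightarrow> smooth_on I (\<lambda>u. h (f u))"
  by (simp add: smooth_on_iff_differentiable_times[OF I] differentiable_times_linear)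

lemma smooth_on_add: "smooth_on I f \<Longrightarrow> smooth_on I g \<Longrightarrow> smooth_on I (\<lambda>u. f u + g u)"
  by (simp add: smooth_on_iff_differentiable_times[OF I] differentiable_times_add)

lemma smooth_on_mult:
  fixes f g :: "real \<Rightarrow> real"
  shows "smooth_on I f \<Longrightarrow> smooth_on I g \<Longrightarrow> smooth_on I (\<lambda>u. f u * g u)"
  by (simp add: smooth_on_iff_differentiable_times[OF I] differentiable_times_mult)

lemma smooth_on_cmult:
  fixes f :: "real \<Rightarrow> real"
  shows "smooth_on I f \<Longrightarrow> smooth_on I (\<lambda>u. c * f u)"
  by (rule smooth_on_mult[OF smooth_on_const])

lemma smooth_on_diff:
  fixes f g :: "real \<Rightarrow> real"
  shows "smooth_on I f \<Longrightarrow> smooth_on I g \<Longrightarrow> smooth_on I (\<lambda>u. f u - g u)"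
  using smooth_on_add[OF _ smooth_on_cmult[of g "-1"], of f] by simp

lemma smooth_on_divide:
  fixes f g :: "real \<Rightarrow> real"
  assumes "smooth_on I f" "smooth_on I g" "\<And>u. u \<in> I \<Longrightarrow> g u \<noteq> 0"
  shows "smooth_on I (\<lambda>u. f u / g u)"
proof -
  have "smooth_on I (\<lambda>u. inverse (g u))"
    using assms(2,3)
    by (simp add: smooth_on_iff_differentiable_times[OF I] differentiable_times_inverse)
  then show ?thesis using smooth_on_mult[OF assms(1)] by (simp add: divide_inverse)
qed

end

lemma smooth_on_deriv:
  fixes f :: "real \<Rightarrow> real"
  shows "smooth_on I f \<Longrightarrow> smooth_on I (deriv f)"
  unfolding field_derivative_eq_vector_derivative[abs_def] by (rule smooth_on_vector_derivative)

lemma smooth_on_has_real_derivative: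
  fixes f :: "real \<Rightarrow> real"
  shows "smooth_on I f \<Longrightarrow> u \<in> I \<Longrightarrow> (f has_real_derivative deriv f u) (at u)"
  using smooth_on_has_vector_derivative[of I f u]
  by (simp add: field_derivative_eq_vector_derivative has_real_derivative_iff_has_vector_derivative)

lemma smooth_on_vec2:
  fixes f g :: "real \<Rightarrow> real"
  assumes "open I" "smooth_on I f" "smooth_on I g"
  shows "smooth_on I (\<lambda>u. vector [f u, g u] :: real^2)"
proof -
  have "vector [f u, g u] = f u *\<^sub>R (axis 1 1 :: real^2) + g u *\<^sub>R axis 2 1" for u
    by (simp add: vec_eq_iff forall_2 axis_def)
  moreover have "smooth_on I (\<lambda>u. f u *\<^sub>R (axis 1 1 :: real^2) + g u *\<^sub>R axis 2 1)"
    using assms by (intro smooth_on_add smooth_on_linear[OF _ bounded_linear_scaleR_left])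
  ultimately show ?thesis by presburger
qed

lemma smooth_on_component:
  "open I \<Longrightarrow> smooth_on I (Y :: real \<Rightarrow> real^2) \<Longrightarrow> smooth_on I (\<lambda>u. Y u $ i)"
  by (rule smooth_on_linear[OF _ bounded_linear_vec_nth])

section \<open>The equation in sheared coordinates\<close>

text \<open>
  The inverse of the shear \<open>(x, y) \<mapsto> (\<sigma>, y)\<close> with \<open>\<sigma> = x - y^2 / 2 + y\<close>. The parabolas among the
  solutions are the lines \<open>\<sigma> = C\<close> in the sheared plane.
\<close>

definition unshear :: "(real \<Rightarrow> real) \<Rightarrow> (real \<Rightarrow> real) \<Rightarrow> real \<Rightarrow> real^2" where
  "unshear \<sigma> y u = vector [\<sigma> u + (y u)\<^sup>2 / 2 - y u, y u]"

definition sheared_abscissa :: "(real \<Rightarrow> real^2) \<Rightarrow> real \<Rightarrow> real" where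
  "sheared_abscissa Y u = Y u $ 1 - (Y u $ 2)\<^sup>2 / 2 + Y u $ 2"

text \<open>
  In terms of \<open>q = deriv y\<close> and \<open>p = deriv \<sigma> - q\<close> the curve equation reads \<open>p q' - q p' = p^3 + q^3\<close>, since
  \<open>p = x' - y y'\<close>. The right-hand side is divisible by \<open>p + q = deriv \<sigma>\<close>.
\<close>

definition sheared_solution :: "real set \<Rightarrow> (real \<Rightarrow> real) \<Rightarrow> (real \<Rightarrow> real) \<Rightarrow> bool" where
  "sheared_solution I \<sigma> y \<longleftrightarrow>
     open I \<and> is_interval I \<and> I \<noteq> {} \<and> smooth_on I \<sigma> \<and> smooth_on I y \<and>
     (\<forall>u\<in>I. (deriv \<sigma> u \<noteq> 0 \<or> deriv y u \<noteq> 0) \<and>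
        deriv \<sigma> u * deriv (deriv y) u - deriv y u * deriv (deriv \<sigma>) u =
        deriv \<sigma> u * ((deriv \<sigma> u)\<^sup>2 - 3 * deriv \<sigma> u * deriv y u + 3 * (deriv y u)\<^sup>2))"

lemma unshear_coordinates: "unshear (sheared_abscissa Y) (\<lambda>u. Y u $ 2) = Y"
  by (rule ext) (simp add: unshear_def sheared_abscissa_def vec_eq_iff forall_2)

lemma smooth_on_unshear_iff:
  assumes "open I"
  shows "smooth_on I (unshear \<sigma> y) \<longleftrightarrow> smooth_on I \<sigma> \<and> smooth_on I y"
proof
  assume Y: "smooth_on I (unshear \<sigma> y)"
  note 1 = smooth_on_component[OF assms Y, of 1] and 2 = smooth_on_component[OF assms Y, of 2]
  have "smooth_on I (\<lambda>u. unshear \<sigma> y u $ 1 - 1/2 * (unshear \<sigma> y u $ 2 * unshear \<sigma> y u $ 2)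
      + unshear \<sigma> y u $ 2)"
    using 1 2 assms by (intro smooth_on_add smooth_on_diff smooth_on_cmult smooth_on_mult)
  with 2 show "smooth_on I \<sigma> \<and> smooth_on I y"
    by (simp add: unshear_def power2_eq_square)
next
  assume "smooth_on I \<sigma> \<and> smooth_on I y"
  then have "smooth_on I (\<lambda>u. vector [\<sigma> u + 1/2 * (y u * y u) - y u, y u] :: real^2)"
    using assms
    by (intro smooth_on_vec2 smooth_on_add smooth_on_diff smooth_on_cmult smooth_on_mult) auto
  then show "smooth_on I (unshear \<sigma> y)"
    by (simp add: unshear_def[abs_def] power2_eq_square)
qed

lemma has_vector_derivative_vec2:
  fixes f g :: "real \<Rightarrow> real"
  assumes "(f has_real_derivative f') (at u)" "(g has_real_derivative g') (at u)"
  shows "((\<lambda>u. vector [f u, g u] :: real^2) has_vector_derivative vector [f', g']) (at u)"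
proof -
  have *: "vector [a, b] = a *\<^sub>R (axis 1 1 :: real^2) + b *\<^sub>R axis 2 1" for a b :: real
    by (simp add: vec_eq_iff forall_2 axis_def)
  show ?thesis
    unfolding * using assms unfolding has_real_derivative_iff_has_vector_derivative
    by (intro has_vector_derivative_add bounded_linear.has_vector_derivative[OF bounded_linear_scaleR_left])
qed

lemma velocity_unshear:
  assumes "(\<sigma> has_real_derivative a) (at u)" "(y has_real_derivative q) (at u)"
  shows "velocity (unshear \<sigma> y) u = vector [a + y u * q - q, q]"
  unfolding velocity_def unshear_def[abs_def]
  by (rule vector_derivative_at has_vector_derivative_vec2 | rule derivative_eq_intros assms refl
      | simp)+

lemma acceleration_unshear:
  assumes "open I" "u \<in> I" "smooth_on I \<sigma>" "smooth_on I y"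
  shows "acceleration (unshear \<sigma> y) u =
    vector [deriv (deriv \<sigma>) u + (deriv y u)\<^sup>2 + y u * deriv (deriv y) u - deriv (deriv y) u,
            deriv (deriv y) u]"
proof -
  let ?V = "\<lambda>v. vector [deriv \<sigma> v + y v * deriv y v - deriv y v, deriv y v] :: real^2"
  note d = smooth_on_has_real_derivative
  have V: "velocity (unshear \<sigma> y) v = ?V v" if "v \<in> I" for v
    using that assms by (intro velocity_unshear d)
  have "(?V has_vector_derivative
      vector [deriv (deriv \<sigma>) u + (deriv y u)\<^sup>2 + y u * deriv (deriv y) u - deriv (deriv y) u,
            deriv (deriv y) u]) (at u)"
    using assms
    by (intro has_vector_derivative_vec2)
      (rule derivative_eq_intros d[of I] smooth_on_deriv refl | assumption
        | simp add: power2_eq_square)+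
  then have "(velocity (unshear \<sigma> y) has_vector_derivative
      vector [deriv (deriv \<sigma>) u + (deriv y u)\<^sup>2 + y u * deriv (deriv y) u - deriv (deriv y) u,
            deriv (deriv y) u]) (at u)"
    using assms(1,2) by (rule has_vector_derivative_transform_within_open) (simp add: V)
  then show ?thesis unfolding acceleration_def by (rule vector_derivative_at)
qed

text \<open>
  After taking cubes both sides are divided by the cube of the speed, which therefore cancels; what
  remains is polynomial in the derivatives.
\<close>

lemma curve_equation_iff:
  fixes Y :: "real \<Rightarrow> real^2"
  assumes "velocity Y u \<noteq> 0"
  shows "((vector [vector [0, 1], vector [0, 0]] :: real^2^2) *v Y u + vector [0, 1])
      \<bullet> unit_normal Y u = root 3 (curvature Y u) \<longleftrightarrow>
    velocity Y u $ 1 * acceleration Y u $ 2 - velocity Y u $ 2 * acceleration Y u $ 1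
      = (velocity Y u $ 1 - Y u $ 2 * velocity Y u $ 2) ^ 3"
    (is "?L = ?R \<longleftrightarrow> ?d = ?c ^ 3")
proof -
  let ?n = "norm (velocity Y u)"
  have n: "?n > 0" using assms by simp
  have L: "?L = ?c / ?n"
    unfolding unit_normal_def unit_tangent_def rotJ_def
    by (simp add: inner_vec_def matrix_vector_mult_def sum_2 divide_inverse algebra_simps)
  have "root 3 (?n ^ 3) = ?n" using n by (intro real_root_power_cancel) auto
  then have R: "?R = root 3 ?d / ?n"
    unfolding curvature_def by (simp add: det_2 transpose_def real_root_divide field_simps)
  have "?L = ?R \<longleftrightarrow> root 3 ?d = ?c" unfolding L R using n by auto
  also have "\<dots> \<longleftrightarrow> ?d = ?c ^ 3"
    by (metis odd_numeral odd_real_root_power_cancel odd_real_root_pow numeral_3_eq_3)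
  finally show ?thesis .
qed

lemma solution_unshear_iff: "solution I (unshear \<sigma> y) \<longleftrightarrow> sheared_solution I \<sigma> y"
proof -
  have "velocity (unshear \<sigma> y) u \<noteq> 0 \<longleftrightarrow> deriv \<sigma> u \<noteq> 0 \<or> deriv y u \<noteq> 0" (is ?V)
    and "velocity (unshear \<sigma> y) u \<noteq> 0 \<Longrightarrow>
      ((vector [vector [0, 1], vector [0, 0]] :: real^2^2) *v unshear \<sigma> y u + vector [0, 1])
        \<bullet> unit_normal (unshear \<sigma> y) u = root 3 (curvature (unshear \<sigma> y) u) \<longleftrightarrow>
      deriv \<sigma> u * deriv (deriv y) u - deriv y u * deriv (deriv \<sigma>) u =
        deriv \<sigma> u * ((deriv \<sigma> u)\<^sup>2 - 3 * deriv \<sigma> u * deriv y u + 3 * (deriv y u)\<^sup>2)"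
      (is "_ \<Longrightarrow> ?E")
    if "open I" "smooth_on I \<sigma>" "smooth_on I y" "u \<in> I" for u
  proof -
    note v = velocity_unshear[OF that(2,3)[THEN smooth_on_has_real_derivative, OF that(4)]]
    show ?V unfolding v by (auto simp: vec_eq_iff forall_2)
    assume "velocity (unshear \<sigma> y) u \<noteq> 0"
    note e = curve_equation_iff[OF this]
    show ?E
      unfolding e unfolding v acceleration_unshear[OF that(1,4,2,3)]
      by (simp add: unshear_def power2_eq_square power3_eq_cube algebra_simps)
  qed
  then show ?thesis
    unfolding solution_def immersed_curve_def sheared_solution_def
    using smooth_on_unshear_iff[of I \<sigma> y] by blast
qed

lemma solution_unshearE:
  assumes "solution I Y"
  obtains \<sigma> y where "Y = unshear \<sigma> y" "sheared_solution I \<sigma> y"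
  using assms unshear_coordinates solution_unshear_iff by metis

section \<open>The joined curve in closed form\<close>

text \<open>
  The angle \<open>turning\<close> is normalized to vanish at \<open>t = 0\<close>; up to the factor \<open>2 / sqrt 3\<close> it is the
  antiderivative of \<open>1 / (3 t^2 - 3 t + 1)\<close>. The function \<open>height\<close> is the antiderivative of
  \<open>t / (3 t^2 - 3 t + 1)\<close> that vanishes at \<open>t = 0\<close>.
\<close>

definition turning :: "real \<Rightarrow> real" where
  "turning t = arctan (sqrt 3 * (2 * t - 1)) + pi / 3"

definition height :: "real \<Rightarrow> real" where
  "height t = ln (3 * t\<^sup>2 - 3 * t + 1) / 6 + turning t / sqrt 3"

lemma height_argument_pos: "3 * t\<^sup>2 - 3 * t + 1 > (0::real)"
proof -
  have "3 * t\<^sup>2 - 3 * t + 1 = 3 * (t - 1/2)\<^sup>2 + 1/4" by (simp add: power2_eq_square algebra_simps)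
  also have "\<dots> > 0" by (intro add_nonneg_pos mult_nonneg_nonneg) auto
  finally show ?thesis .
qed

lemma turning_has_derivative:
  "((\<lambda>t. 2 / sqrt 3 * turning t) has_real_derivative 1 / (3 * t\<^sup>2 - 3 * t + 1)) (at t)"
proof -
  define D where "D = 3 * t\<^sup>2 - 3 * t + 1"
  have D: "1 + (sqrt 3 * (2 * t - 1))\<^sup>2 = 4 * D"
    by (simp add: D_def power_mult_distrib power2_eq_square algebra_simps)
  have e: "2 / sqrt 3 * (sqrt 3 * 2 / (1 + (sqrt 3 * (2 * t - 1))\<^sup>2)) = 1 / D"
    unfolding D by simp
  have "((\<lambda>t. sqrt 3 * (2 * t - 1)) has_real_derivative sqrt 3 * 2) (at t)"
    by (rule DERIV_cmult) (auto intro!: derivative_eq_intros)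
  from DERIV_cmult[OF DERIV_add[OF DERIV_chain2[OF DERIV_arctan this] DERIV_const[of "pi / 3"]],
      of "2 / sqrt 3"]
  have "((\<lambda>t. 2 / sqrt 3 * turning t) has_real_derivative
      2 / sqrt 3 * (sqrt 3 * 2 / (1 + (sqrt 3 * (2 * t - 1))\<^sup>2))) (at t)"
    unfolding turning_def[abs_def] by (simp only: divide_inverse mult_ac add_0_right)
  then show ?thesis unfolding e D_def .
qed

lemma height_has_derivative:
  "(height has_real_derivative t / (3 * t\<^sup>2 - 3 * t + 1)) (at t)"
proof -
  define D where "D = 3 * t\<^sup>2 - 3 * t + 1"
  have D: "D > 0" using height_argument_pos by (simp add: D_def)
  have "((\<lambda>t. 3 * t\<^sup>2 - 3 * t + 1) has_real_derivative 6 * t - 3) (at t)"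
    by (auto intro!: derivative_eq_intros)
  from DERIV_chain2[OF DERIV_ln this] D
  have "((\<lambda>t. ln (3 * t\<^sup>2 - 3 * t + 1)) has_real_derivative inverse D * (6 * t - 3)) (at t)"
    by (simp add: D_def)
  from DERIV_add[OF DERIV_cdivide[OF this, of 6]
      DERIV_cmult[OF turning_has_derivative[of t, folded D_def], of "1/2"]]
  have "(height has_real_derivative inverse D * (6 * t - 3) / 6 + 1/2 * (1 / D)) (at t)"
    by (simp add: height_def[abs_def])
  moreover have "inverse D * (6 * t - 3) / 6 + 1/2 * (1 / D) = t / D"
    using D by (simp add: field_simps)
  ultimately show ?thesis by (simp add: D_def)
qed

lemma turning_0: "turning 0 = 0"
proof -
  have "arctan (sqrt 3) = pi / 3"
  proof (rule arctan_unique)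
    show "- (pi / 2) < pi / 3" "pi / 3 < pi / 2" using pi_gt_zero by linarith+
  qed (rule tan_60)
  then show ?thesis by (simp add: turning_def arctan_minus)
qed

lemma height_0: "height 0 = 0"
  by (simp add: height_def turning_0)

text \<open>The derivative of \<^const>\<open>height\<close> has the sign of its argument.\<close>

lemma height_nonneg: "height t \<ge> 0"
proof (cases "t \<ge> 0")
  case True
  then have "height 0 \<le> height t"
    by (intro DERIV_nonneg_imp_nondecreasing[OF True])
      (meson height_has_derivative height_argument_pos divide_nonneg_pos)
  then show ?thesis by (simp add: height_0)
next
  case False
  then have "height t \<ge> height 0"
    by (intro DERIV_nonpos_imp_nonincreasing[of t 0])
      (meson height_has_derivative height_argument_pos divide_nonpos_pos not_le less_imp_le)+
  then show ?thesis by (simp add: height_0)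
qed

text \<open>
  With \<open>w = 1 - 1 / t\<close> the argument \<open>(2 w + 1) / sqrt 3\<close> equals \<open>(3 t - 2) / (sqrt 3 t)\<close>. It has a pole
  at \<open>t = 0\<close>, so its arctangent differs from the continuous angle \<^const>\<open>turning\<close> by a quarter turn
  whose sign changes there.
\<close>

lemma arctan_turning:
  assumes "t \<noteq> 0"
  shows "arctan ((2 * (1 - 1 / t) + 1) / sqrt 3) =
    turning t + (if t < 0 then pi / 2 else - (pi / 2))"
proof (rule arctan_unique)
  define \<alpha> where "\<alpha> = arctan (sqrt 3 * (2 * t - 1))"
  have T: "turning t = \<alpha> + pi / 3" by (simp add: turning_def \<alpha>_def)
  have range: "\<alpha> > - (pi / 2)" "\<alpha> < pi / 2"
    unfolding \<alpha>_def by (rule arctan_lbound, rule arctan_ubound)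
  moreover have "\<alpha> < - (pi / 3) \<longleftrightarrow> t < 0" "\<alpha> > - (pi / 3) \<longleftrightarrow> t > 0"
  proof -
    have *: "- (pi / 3) = arctan (sqrt 3 * (2 * 0 - 1))"
      using turning_0 by (simp add: turning_def)
    show "\<alpha> < - (pi / 3) \<longleftrightarrow> t < 0" "\<alpha> > - (pi / 3) \<longleftrightarrow> t > 0"
      unfolding \<alpha>_def * arctan_less_iff by (subst mult_less_cancel_left_pos; simp)+
  qed
  ultimately show "- (pi / 2) < turning t + (if t < 0 then pi / 2 else - (pi / 2))"
    "turning t + (if t < 0 then pi / 2 else - (pi / 2)) < pi / 2"
    using assms by (auto simp: T)
  have c: "cos \<alpha> > 0"
    using range by (rule cos_gt_zero_pi)
  have "tan \<alpha> = sqrt 3 * (2 * t - 1)" unfolding \<alpha>_def by (rule tan_arctan)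
  \<comment> \<open>Sine and cosine of \<open>turning t\<close> become multiples of \<open>cos \<alpha>\<close>, which cancels in the cotangent.\<close>
  with c have s: "sin \<alpha> = sqrt 3 * (2 * t - 1) * cos \<alpha>" by (simp add: tan_def divide_eq_eq)
  have S: "sin (turning t) = sqrt 3 * t * cos \<alpha>"
    unfolding T sin_add sin_60 cos_60 by (simp add: s algebra_simps)
  have C: "cos (turning t) = (2 - 3 * t) * cos \<alpha>"
  proof -
    have "sqrt 3 * sin \<alpha> = 3 * ((2 * t - 1) * cos \<alpha>)" by (simp add: s)
    then show ?thesis unfolding T cos_add sin_60 cos_60 by (simp add: algebra_simps)
  qed
  have "tan (turning t + (if t < 0 then pi / 2 else - (pi / 2))) =
      - cos (turning t) / sin (turning t)"
    by (simp add: tan_def sin_add cos_add)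
  also have "\<dots> = (3 * t - 2) / (sqrt 3 * t)"
    unfolding S C using c assms by (simp add: field_simps)
  finally show "tan (turning t + (if t < 0 then pi / 2 else - (pi / 2))) =
      (2 * (1 - 1 / t) + 1) / sqrt 3"
    using assms by (simp add: field_simps)
qed

lemma projective_quadratic: "1 + (1 - 1 / t) + (1 - 1 / t)\<^sup>2 = (3 * t\<^sup>2 - 3 * t + 1) / t\<^sup>2"
  if "t \<noteq> 0" for t :: real
  using that by (simp add: field_simps power2_eq_square)

lemma y_plus_projective:
  assumes "t < 0"
  shows "y_plus (1 - 1 / t) = height t"
proof -
  have 1: "ln (1 - 1 / t - 1) = - ln (- t)" using assms ln_inverse[of "- t"] by (simp add: divide_inverse)
  have 2: "ln (1 + (1 - 1 / t) + (1 - 1 / t)\<^sup>2) = ln (3 * t\<^sup>2 - 3 * t + 1) - 2 * ln (- t)"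
    using assms projective_quadratic[of t] height_argument_pos[of t] ln_realpow[of "- t" 2]
    by (simp add: ln_div)
  have 3: "arctan ((2 * (1 - 1 / t) + 1) / sqrt 3) = turning t + pi / 2"
    using assms arctan_turning[of t] by simp
  show ?thesis
    unfolding y_plus_def height_def 1 2 3 by (simp add: algebra_simps add_divide_distrib diff_divide_distrib)
qed

lemma y_minus_projective:
  assumes "t > 0"
  shows "y_minus (1 - 1 / t) = height t"
proof -
  have 1: "ln (1 - (1 - 1 / t)) = - ln t" using assms ln_inverse[of t] by (simp add: divide_inverse)
  have 2: "ln (1 + (1 - 1 / t) + (1 - 1 / t)\<^sup>2) = ln (3 * t\<^sup>2 - 3 * t + 1) - 2 * ln t"
    using assms projective_quadratic[of t] height_argument_pos[of t] ln_realpow[of t 2]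
    by (simp add: ln_div)
  have 3: "arctan ((2 * (1 - 1 / t) + 1) / sqrt 3) = turning t - pi / 2"
    using assms arctan_turning[of t] by simp
  show ?thesis
    unfolding y_minus_def height_def 1 2 3 by (simp add: algebra_simps add_divide_distrib diff_divide_distrib)
qed

lemma y_plus_eq: "w > 1 \<Longrightarrow> y_plus w = height (1 / (1 - w))"
  using y_plus_projective[of "1 / (1 - w)"] by simp

lemma y_minus_eq: "w < 1 \<Longrightarrow> y_minus w = height (1 / (1 - w))"
  using y_minus_projective[of "1 / (1 - w)"] by simp

lemma height_square_has_derivative:
  assumes "w \<noteq> 1"
  shows "((\<lambda>w. (height (1 / (1 - w)))\<^sup>2 / 2) has_real_derivative
    height (1 / (1 - w)) / (1 - w ^ 3)) (at w)"
proof -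
  define t where "t = 1 / (1 - w)"
  have t: "t \<noteq> 0" "w = 1 - 1 / t" using assms by (auto simp: t_def)
  have "1 - w ^ 3 = (3 * t\<^sup>2 - 3 * t + 1) / t ^ 3"
    using t(1) unfolding t(2) by (simp add: field_simps power2_eq_square power3_eq_cube)
  \<comment> \<open>The factor \<open>t^2\<close> is the derivative of \<open>t\<close> with respect to \<open>w\<close>.\<close>
  then have e: "t / (3 * t\<^sup>2 - 3 * t + 1) * t\<^sup>2 = 1 / (1 - w ^ 3)"
    by (simp add: power2_eq_square power3_eq_cube)
  have g: "((\<lambda>w. 1 / (1 - w)) has_real_derivative t\<^sup>2) (at w)"
    using assms by (auto intro!: derivative_eq_intros simp: t_def power2_eq_square)
  have "((\<lambda>w. height (1 / (1 - w))) has_real_derivative 1 / (1 - w ^ 3)) (at w)"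
    unfolding e[symmetric]
    by (rule DERIV_chain2[OF _ g]) (unfold t_def, rule height_has_derivative)
  moreover have "((\<lambda>x. x\<^sup>2 / 2) has_real_derivative c) (at c)" for c :: real
    by (auto intro!: derivative_eq_intros)
  ultimately have "((\<lambda>w. (height (1 / (1 - w)))\<^sup>2 / 2) has_real_derivative
      height (1 / (1 - w)) * (1 / (1 - w ^ 3))) (at w)"
    by (rule DERIV_chain2[rotated])
  then show ?thesis by simp
qed

lemma height_at_infinity:
  "((\<lambda>w. height (1 / (1 - w))) \<longlongrightarrow> 0) at_top" "((\<lambda>w. height (1 / (1 - w))) \<longlongrightarrow> 0) at_bot"
proof -
  have "isCont height 0" using height_has_derivative by (rule DERIV_isCont)
  then have *: "((\<lambda>w. height (f w)) \<longlongrightarrow> 0) F" if "(f \<longlongrightarrow> 0) F" for f and F :: "real filter"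
    using isCont_tendsto_compose[OF \<open>isCont height 0\<close> that] by (simp add: height_0)
  show "((\<lambda>w. height (1 / (1 - w))) \<longlongrightarrow> 0) at_top" by (rule *) real_asymp
  show "((\<lambda>w. height (1 / (1 - w))) \<longlongrightarrow> 0) at_bot" by (rule *) real_asymp
qed

lemma integral_atLeast_nonneg_FTC:
  fixes F f :: "real \<Rightarrow> real"
  assumes "\<And>x. x \<ge> a \<Longrightarrow> (F has_real_derivative f x) (at x)" "\<And>x. x \<ge> a \<Longrightarrow> f x \<ge> 0"
    and "(F \<longlongrightarrow> T) at_top"
  shows "(f has_integral T - F a) {a..}"
proof (rule has_integral_to_inf)
  have i: "(f has_integral F y - F a) {a..y}" if "y \<ge> a" for y
    using that
  proof (rule fundamental_theorem_of_calculus)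
    fix x assume "x \<in> {a..y}"
    then have "(F has_real_derivative f x) (at x within {a..y})"
      using assms(1)[of x] by (simp add: has_field_derivative_at_within)
    then show "(F has_vector_derivative f x) (at x within {a..y})"
      by (simp add: has_real_derivative_iff_has_vector_derivative)
  qed
  show "f integrable_on {a..y}" for y
    using i[of y] by (cases "y \<ge> a") (auto dest: has_integral_integrable)
  have "\<forall>\<^sub>F y in at_top. F y - F a = integral {a..y} f"
    using eventually_ge_at_top[of a] by eventually_elim (simp add: integral_unique[OF i])
  then show "((\<lambda>y. integral {a..y} f) \<longlongrightarrow> T - F a) at_top"
    by (rule Lim_transform_eventually[rotated]) (intro tendsto_intros assms(3))
qed (use assms(2) in auto)

text \<open>By reflection at the origin.\<close>

lemma integral_atMost_nonneg_FTC:
  fixes F f :: "real \<Rightarrow> real"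
  assumes "\<And>x. x \<le> b \<Longrightarrow> (F has_real_derivative f x) (at x)" "\<And>x. x \<le> b \<Longrightarrow> f x \<ge> 0"
    and "(F \<longlongrightarrow> T) at_bot"
  shows "integral {..b} f = F b - T"
proof -
  have "((\<lambda>x. f (- x)) has_integral - T - - F (- (- b))) {- b..}"
  proof (rule integral_atLeast_nonneg_FTC)
    show "((\<lambda>x. - F (- x)) has_real_derivative f (- x)) (at x)" if "x \<ge> - b" for x
      using DERIV_minus[OF DERIV_mirror[where f = F and x = x and y = "f (- x)", THEN iffD1, OF assms(1)]] that by simp
    show "((\<lambda>x. - F (- x)) \<longlongrightarrow> - T) at_top"
      using assms(3) by (intro tendsto_minus filterlim_compose[OF _ filterlim_uminus_at_bot_at_top])
  qed (use assms(2) in auto)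
  then have i: "((\<lambda>x. f (- x)) has_integral F b - T) {- b..}" by simp
  have "(\<lambda>x. f (- x)) absolutely_integrable_on {- b..} \<and>
      integral {- b..} (\<lambda>x. f (- x)) = F b - T"
    using assms(2) i
    by (intro conjI nonnegative_absolutely_integrable_1 integral_unique[OF i]) auto
  then show ?thesis
    using has_absolute_integral_reflect_real[of "{- b..}" "{..b}" f "F b - T"] by auto
qed

text \<open>
  Up to sign the integrand is the derivative of \<open>y_plus^2 / 2\<close> or \<open>y_minus^2 / 2\<close>, because both
  functions have the derivative \<open>1 / (1 - w^3)\<close>; the boundary terms at infinity vanish.
\<close>

lemma integral_y_plus:
  assumes "w > 1"
  shows "integral {w..} (\<lambda>\<xi>. y_plus \<xi> / (\<xi> ^ 3 - 1)) = (y_plus w)\<^sup>2 / 2"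
proof -
  let ?F = "\<lambda>w. - ((height (1 / (1 - w)))\<^sup>2 / 2)"
  have "((\<lambda>\<xi>. y_plus \<xi> / (\<xi> ^ 3 - 1)) has_integral 0 - ?F w) {w..}"
  proof (rule integral_atLeast_nonneg_FTC)
    fix x assume x: "x \<ge> w"
    have "y_plus x / (x ^ 3 - 1) = - (height (1 / (1 - x)) / (1 - x ^ 3))"
      using x assms by (metis y_plus_eq minus_diff_eq minus_divide_right order_less_le_trans)
    then show "(?F has_real_derivative y_plus x / (x ^ 3 - 1)) (at x)"
      using DERIV_minus[OF height_square_has_derivative[of x]] x assms by simp
    show "y_plus x / (x ^ 3 - 1) \<ge> 0"
      using x assms height_nonneg one_less_power[of x 3] by (simp add: y_plus_eq)
  next
    show "(?F \<longlongrightarrow> 0) at_top"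
      using height_at_infinity(1) by (auto intro!: tendsto_eq_intros)
  qed
  then show ?thesis using assms by (simp add: y_plus_eq integral_unique)
qed

lemma integral_y_minus:
  assumes "w < 1"
  shows "integral {..w} (\<lambda>\<xi>. y_minus \<xi> / (1 - \<xi> ^ 3)) = (y_minus w)\<^sup>2 / 2"
proof -
  let ?F = "\<lambda>w. (height (1 / (1 - w)))\<^sup>2 / 2"
  have "integral {..w} (\<lambda>\<xi>. y_minus \<xi> / (1 - \<xi> ^ 3)) = ?F w - 0"
  proof (rule integral_atMost_nonneg_FTC)
    fix x assume x: "x \<le> w"
    show "(?F has_real_derivative y_minus x / (1 - x ^ 3)) (at x)"
      using height_square_has_derivative[of x] x assms by (simp add: y_minus_eq)
    have "x ^ 3 \<le> 1 ^ 3"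
      using x assms by (intro power_mono_odd) auto
    then show "y_minus x / (1 - x ^ 3) \<ge> 0"
      using x assms height_nonneg by (simp add: y_minus_eq)
  next
    show "(?F \<longlongrightarrow> 0) at_bot"
      using height_at_infinity(2) by (auto intro!: tendsto_eq_intros)
  qed
  then show ?thesis using assms by (simp add: y_minus_eq)
qed

text \<open>
  At \<open>t = 0\<close> the limits for \<open>w\<close> tending to \<open>\<infinity>\<close> are the values of the closed form because the latter
  is continuous there. The constant of \<open>\<sigma>\<close> comes from \<open>(height + C1)^2 / 2\<close>, expanded and compared with the first coordinate.
\<close>

lemma joined_curve_closed_form:
  "joined_curve C1 C2 =
    unshear (\<lambda>t. 2 / sqrt 3 * turning t + (C2 - C1\<^sup>2 / 2 + C1)) (\<lambda>t. height t + C1)"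
proof
  fix t
  let ?x = "\<lambda>t. (height t)\<^sup>2 / 2 + (C1 - 1) * height t + 2 / sqrt 3 * turning t + C2"
  have x: "x_coord C1 C2 (1 - 1 / t) = ?x t" and y: "y_coord C1 (1 - 1 / t) = height t + C1"
    if "t \<noteq> 0" for t
  proof -
    consider "t < 0" | "t > 0" using \<open>t \<noteq> 0\<close> by linarith
    then have "x_coord C1 C2 (1 - 1 / t) = ?x t \<and> y_coord C1 (1 - 1 / t) = height t + C1"
    proof cases
      case 1
      then have W: "(1 - 1 / t > 1) = True" and w: "1 - 1 / t > 1" by auto
      have A: "arctan ((2 * (1 - 1 / t) + 1) / sqrt 3) = turning t + pi / 2"
        using 1 arctan_turning[of t] by simp
      note y = y_plus_projective[OF 1]
      show ?thesis
        unfolding x_coord_def y_coord_def W if_True integral_y_plus[OF w] y A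
        by (simp add: algebra_simps add_divide_distrib diff_divide_distrib)
    next
      case 2
      then have W: "(1 - 1 / t > 1) = False" and w: "1 - 1 / t < 1" by auto
      have A: "arctan ((2 * (1 - 1 / t) + 1) / sqrt 3) = turning t - pi / 2"
        using 2 arctan_turning[of t] by simp
      note y = y_minus_projective[OF 2]
      show ?thesis
        unfolding x_coord_def y_coord_def W if_False integral_y_minus[OF w] y A
        by (simp add: algebra_simps add_divide_distrib diff_divide_distrib)
    qed
    then show "x_coord C1 C2 (1 - 1 / t) = ?x t" "y_coord C1 (1 - 1 / t) = height t + C1"
      by auto
  qed
  have X: "Lim at_top (x_coord C1 C2) = ?x 0" and Y: "Lim at_top (y_coord C1) = height 0 + C1"
  proof -
    have "isCont turning 0"
      unfolding turning_def[abs_def] by (intro continuous_intros) simp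
    moreover have "isCont height 0" using height_has_derivative by (rule DERIV_isCont)
    ultimately have c: "isCont ?x 0" "isCont (\<lambda>t. height t + C1) 0"
      by (auto intro!: continuous_intros)
    have lim: "((\<lambda>w::real. 1 / (1 - w)) \<longlongrightarrow> 0) at_top" by real_asymp
    have "\<forall>\<^sub>F w in at_top. ?x (1 / (1 - w)) = x_coord C1 C2 w"
      using eventually_gt_at_top[of 1]
    proof eventually_elim
      case (elim w)
      then show ?case using x[of "1 / (1 - w)"] by simp
    qed
    then show "Lim at_top (x_coord C1 C2) = ?x 0"
      by (intro tendsto_Lim Lim_transform_eventually[OF isCont_tendsto_compose[OF c(1) lim]]) auto
    have "\<forall>\<^sub>F w in at_top. height (1 / (1 - w)) + C1 = y_coord C1 w"
      using eventually_gt_at_top[of 1]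
    proof eventually_elim
      case (elim w)
      then show ?case using y[of "1 / (1 - w)"] by simp
    qed
    then show "Lim at_top (y_coord C1) = height 0 + C1"
      by (intro tendsto_Lim Lim_transform_eventually[OF isCont_tendsto_compose[OF c(2) lim]]) auto
  qed
  have "joined_curve C1 C2 t = vector [?x t, height t + C1]"
    unfolding joined_curve_def using x y X Y by simp
  then show "joined_curve C1 C2 t =
    unshear (\<lambda>t. 2 / sqrt 3 * turning t + (C2 - C1\<^sup>2 / 2 + C1)) (\<lambda>t. height t + C1) t"
    by (simp add: unshear_def power2_eq_square algebra_simps add_divide_distrib)
qed

section \<open>The solutions\<close>

lemma parabola_eq_unshear: "parabola C = unshear (\<lambda>_. C) (\<lambda>v. v)"
  by (simp add: fun_eq_iff parabola_def unshear_def algebra_simps)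

lemma solution_parabola: "solution UNIV (parabola C)"
  unfolding parabola_eq_unshear solution_unshear_iff sheared_solution_def
  by (simp add: smooth_on_const smooth_on_ident)

text \<open>
  In the sheared plane the joined curve is thus parametrized by its own slope \<open>t\<close>, the quotient of the
  two derivatives.
\<close>

lemma joined_curve_sheared_derivatives:
  fixes t :: real
  defines "D \<equiv> 3 * t\<^sup>2 - 3 * t + 1"
  shows "((\<lambda>t. 2 / sqrt 3 * turning t + c) has_real_derivative 1 / D) (at t)"
    and "((\<lambda>t. height t + c) has_real_derivative t / D) (at t)"
  unfolding D_def using DERIV_add[OF turning_has_derivative DERIV_const, of c t]
    DERIV_add[OF height_has_derivative DERIV_const, of c t] by simp_all

text \<open>
  With \<open>a = 1 / D\<close> and \<open>q = t / D\<close> the left-hand side of the sheared equation is \<open>1 / D^2\<close>, and the bracket on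
  the right is \<open>D / D^2\<close>.
\<close>

lemma solution_joined_curve: "solution UNIV (joined_curve C1 C2)"
proof -
  let ?D = "\<lambda>t::real. 3 * t\<^sup>2 - 3 * t + 1"
  define \<sigma> where "\<sigma> = (\<lambda>t. 2 / sqrt 3 * turning t + (C2 - C1\<^sup>2 / 2 + C1))"
  define y where "y = (\<lambda>t. height t + C1)"
  have D: "?D t \<noteq> 0" for t using height_argument_pos[of t] by simp
  have d\<sigma>: "(\<sigma> has_real_derivative 1 / ?D t) (at t)" and dy: "(y has_real_derivative t / ?D t) (at t)" for t
    unfolding \<sigma>_def y_def by (rule joined_curve_sheared_derivatives)+
  have "smooth_on UNIV (\<lambda>t. 3 * (t * t) - 3 * t + 1 :: real)"
    by (intro smooth_on_add smooth_on_diff smooth_on_cmult smooth_on_mult smooth_on_ident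
        smooth_on_const open_UNIV)
  then have sD: "smooth_on UNIV ?D" by (simp add: power2_eq_square)
  have sf: "smooth_on UNIV (\<lambda>t. 1 / ?D t)" "smooth_on UNIV (\<lambda>t. t / ?D t)"
    using D by (intro smooth_on_divide[OF _ _ sD] smooth_on_ident smooth_on_const open_UNIV; simp)+
  have s: "smooth_on UNIV \<sigma>" "smooth_on UNIV y"
    using smooth_on_antiderivative[OF open_UNIV _ sf(1), of \<sigma>]
      smooth_on_antiderivative[OF open_UNIV _ sf(2), of y] d\<sigma> dy
    by (simp_all add: has_real_derivative_iff_has_vector_derivative)
  have d: "deriv \<sigma> = (\<lambda>t. 1 / ?D t)" "deriv y = (\<lambda>t. t / ?D t)"
    by (rule ext, rule DERIV_imp_deriv, rule d\<sigma>) (rule ext, rule DERIV_imp_deriv, rule dy)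
  have dd: "deriv (\<lambda>t. 1 / ?D t) t = (0 * ?D t - 1 * (6 * t - 3)) / (?D t * ?D t)"
    "deriv (\<lambda>t. t / ?D t) t = (1 * ?D t - t * (6 * t - 3)) / (?D t * ?D t)" for t
  proof -
    have dD: "(?D has_real_derivative 6 * t - 3) (at t)" by (auto intro!: derivative_eq_intros)
    show "deriv (\<lambda>t. 1 / ?D t) t = (0 * ?D t - 1 * (6 * t - 3)) / (?D t * ?D t)"
      by (rule DERIV_imp_deriv[OF DERIV_divide[OF DERIV_const dD D]])
    show "deriv (\<lambda>t. t / ?D t) t = (1 * ?D t - t * (6 * t - 3)) / (?D t * ?D t)"
      by (rule DERIV_imp_deriv[OF DERIV_divide[OF DERIV_ident dD D]])
  qed
  have eq: "1 / d * ((1 * d - t * (6 * t - 3)) / (d * d)) - t / d * ((0 * d - 1 * (6 * t - 3)) / (d * d)) =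
      1 / d * ((1 / d)\<^sup>2 - 3 * (1 / d) * (t / d) + 3 * (t / d)\<^sup>2)"
    if "d = ?D t" "d \<noteq> 0" for d t :: real
  proof -
    \<comment> \<open>The terms with \<open>6 t - 3\<close> cancel before the value of \<open>d\<close> is used.\<close>
    have "1 / d * ((1 * d - t * (6 * t - 3)) / (d * d)) - t / d * ((0 * d - 1 * (6 * t - 3)) / (d * d))
        = d / d ^ 3"
      using that(2) by (simp add: power3_eq_cube field_simps)
    also have "\<dots> = ?D t / d ^ 3" using that(1) by simp
    also have "\<dots> = 1 / d * ((1 / d)\<^sup>2 - 3 * (1 / d) * (t / d) + 3 * (t / d)\<^sup>2)"
      by (simp add: power2_eq_square power3_eq_cube diff_divide_distrib add_divide_distrib algebra_simps)
    finally show ?thesis .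
  qed
  have "sheared_solution UNIV \<sigma> y"
    unfolding sheared_solution_def d dd
  proof (intro conjI ballI s)
    show "1 / ?D t * ((1 * ?D t - t * (6 * t - 3)) / (?D t * ?D t)) -
        t / ?D t * ((0 * ?D t - 1 * (6 * t - 3)) / (?D t * ?D t)) =
      1 / ?D t * ((1 / ?D t)\<^sup>2 - 3 * (1 / ?D t) * (t / ?D t) + 3 * (t / ?D t)\<^sup>2)" for t
      by (rule eq[OF refl D])
    show "1 / ?D t \<noteq> 0 \<or> t / ?D t \<noteq> 0" for t using D[of t] by simp
  qed simp_all
  then show ?thesis
    unfolding joined_curve_closed_form \<sigma>_def y_def solution_unshear_iff .
qed

text \<open>The product of \<open>a\<close> with the integrating factor \<open>exp (- H)\<close>, where \<open>H' = h\<close>, is constant.\<close>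

lemma linear_ode_zero:
  fixes a h :: "real \<Rightarrow> real"
  assumes h: "continuous_on {\<alpha>..\<beta>} h"
    and a: "\<And>u. u \<in> {\<alpha>..\<beta>} \<Longrightarrow> (a has_real_derivative h u * a u) (at u within {\<alpha>..\<beta>})"
    and "u0 \<in> {\<alpha>..\<beta>}" "a u0 = 0" "u \<in> {\<alpha>..\<beta>}"
  shows "a u = 0"
proof -
  define H where "H = (\<lambda>u. integral {\<alpha>..u} h)"
  have H: "(H has_real_derivative h v) (at v within {\<alpha>..\<beta>})" if "v \<in> {\<alpha>..\<beta>}" for v
    unfolding H_def has_real_derivative_iff_has_vector_derivative
    using h that by (rule integral_has_vector_derivative)
  have "((\<lambda>u. a u * exp (- H u)) has_real_derivative 0) (at v within {\<alpha>..\<beta>})"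
    if "v \<in> {\<alpha>..\<beta>}" for v
    by (rule derivative_eq_intros a[OF that] H[OF that] refl | simp)+
  from has_field_derivative_zero_constant[OF convex_real_interval(5) this]
  obtain c where "\<And>v. v \<in> {\<alpha>..\<beta>} \<Longrightarrow> a v * exp (- H v) = c" by blast
  then have "a u * exp (- H u) = a u0 * exp (- H u0)" using assms(3,5) by simp
  then show ?thesis using assms(4) by simp
qed

text \<open>
  Along a solution the derivative \<open>a\<close> of the sheared abscissa satisfies a linear equation
  \<open>a' = h a\<close> near each of its zeros, where the other derivative does not vanish. Hence the zeros form
  an open and closed set.
\<close>

lemma sheared_solution_dichotomy:
  assumes "sheared_solution I \<sigma> y"
  shows "(\<forall>u\<in>I. deriv \<sigma> u = 0) \<or> (\<forall>u\<in>I. deriv \<sigma> u \<noteq> 0)"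
proof -
  define a q a' q' where "a = deriv \<sigma>" and "q = deriv y" and "a' = deriv a" and "q' = deriv q"
  have I: "open I" "is_interval I" and s: "smooth_on I \<sigma>" "smooth_on I y"
    and reg: "\<And>u. u \<in> I \<Longrightarrow> a u \<noteq> 0 \<or> q u \<noteq> 0"
    and eq: "\<And>u. u \<in> I \<Longrightarrow> a u * q' u - q u * a' u = a u * ((a u)\<^sup>2 - 3 * a u * q u + 3 * (q u)\<^sup>2)"
    using assms unfolding sheared_solution_def a_def q_def a'_def q'_def by auto
  note sm = s[THEN smooth_on_deriv, folded a_def q_def]
  have da: "(a has_real_derivative a' u) (at u)" if "u \<in> I" for u
    unfolding a'_def using sm(1) that by (rule smooth_on_has_real_derivative)
  have cont: "continuous_on I f" if "smooth_on I f" for f :: "real \<Rightarrow> real"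
    by (rule DERIV_continuous_on, rule has_field_derivative_at_within)
      (rule smooth_on_has_real_derivative[OF that])
  have ca: "continuous_on I a" "continuous_on I q" "continuous_on I q'"
    using sm smooth_on_deriv[OF sm(2)] by (auto intro: cont simp: q'_def)
  define Z where "Z = {u \<in> I. a u = 0}"
  define N where "N = {u \<in> I. a u \<noteq> 0}"
  have open_nonzero: "open {u \<in> I. f u \<noteq> 0}" if "continuous_on I f" for f :: "real \<Rightarrow> real"
  proof -
    have "{u \<in> I. f u \<noteq> 0} = I \<inter> f -` (- {0})" by auto
    then show ?thesis using continuous_open_preimage[OF that I(1), of "- {0}"] by (simp add: open_Compl)
  qed
  have "\<exists>e>0. ball u0 e \<subseteq> Z" if u0: "u0 \<in> Z" for u0
  proof -
    have "u0 \<in> {u \<in> I. q u \<noteq> 0}" using u0 reg unfolding Z_def by auto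
    then obtain e where e: "e > 0" "cball u0 e \<subseteq> {u \<in> I. q u \<noteq> 0}"
      using open_nonzero[OF ca(2)] open_contains_cball by blast
    define S where "S = {u0 - e..u0 + e}"
    have S: "S \<subseteq> I" "\<And>u. u \<in> S \<Longrightarrow> q u \<noteq> 0" and cball: "cball u0 e = S"
      using e by (auto simp: S_def cball_eq_atLeastAtMost)
    define h where "h = (\<lambda>u. (q' u - ((a u)\<^sup>2 - 3 * a u * q u + 3 * (q u)\<^sup>2)) / q u)"
    have "continuous_on S h"
      unfolding h_def using S by (intro continuous_intros continuous_on_subset[OF _ S(1)] ca) auto
    moreover have "(a has_real_derivative h u * a u) (at u within S)" if "u \<in> S" for u
    proof -
      have u: "u \<in> I" "q u \<noteq> 0" using S that by auto
      then have "h u * a u = a' u" using eq[OF u(1)] by (simp add: h_def field_simps)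
      then show ?thesis using has_field_derivative_at_within[OF da[OF u(1)]] by simp
    qed
    ultimately have "a u = 0" if "u \<in> S" for u
      using linear_ode_zero[of "u0 - e" "u0 + e" h a u0 u] that u0 e(1) unfolding S_def Z_def by auto
    then have "cball u0 e \<subseteq> Z" using S(1) unfolding cball Z_def by auto
    then show ?thesis using e(1) ball_subset_cball by blast
  qed
  then have "open Z" by (simp add: open_contains_ball)
  moreover have "open N" unfolding N_def using ca(1) by (rule open_nonzero)
  moreover have "connected I" using I(2) by (simp add: is_interval_connected)
  ultimately have "Z = {} \<or> N = {}"
    using connectedD[of I Z N] unfolding Z_def N_def by blast
  then show ?thesis unfolding Z_def N_def a_def by blast
qed

lemma reparam_into_unshearD:
  assumes "reparam_into \<phi> I (unshear \<sigma> y) K (unshear \<tau> z)" "u \<in> I"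
  shows "\<sigma> u = \<tau> (\<phi> u)" "y u = z (\<phi> u)"
proof -
  have "unshear \<sigma> y u = unshear \<tau> z (\<phi> u)" using assms unfolding reparam_into_def by blast
  then show "\<sigma> u = \<tau> (\<phi> u)" "y u = z (\<phi> u)"
    by (auto simp: unshear_def vec_eq_iff forall_2)
qed

lemma reparam_into_derivs:
  assumes "reparam_into \<phi> I (unshear \<sigma> y) K (unshear \<tau> z)" "open I" "u \<in> I"
    and "smooth_on K \<tau>" "smooth_on K z"
  shows "deriv \<sigma> u = deriv \<tau> (\<phi> u) * deriv \<phi> u" "deriv y u = deriv z (\<phi> u) * deriv \<phi> u"
    and "deriv \<phi> u \<noteq> 0" "\<phi> u \<in> K"
proof -
  have \<phi>: "(\<phi> has_real_derivative deriv \<phi> u) (at u)" "deriv \<phi> u \<noteq> 0" "\<phi> u \<in> K"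
    using assms(1,3) smooth_on_has_real_derivative unfolding reparam_into_def by blast+
  then show "deriv \<phi> u \<noteq> 0" "\<phi> u \<in> K" by auto
  have *: "deriv f u = deriv g (\<phi> u) * deriv \<phi> u"
    if "smooth_on K g" "\<And>u. u \<in> I \<Longrightarrow> f u = g (\<phi> u)" for f g :: "real \<Rightarrow> real"
  proof -
    have "((\<lambda>u. g (\<phi> u)) has_real_derivative deriv g (\<phi> u) * deriv \<phi> u) (at u)"
      using smooth_on_has_real_derivative[OF that(1) \<phi>(3)] \<phi>(1) by (rule DERIV_chain2)
    then have "(f has_real_derivative deriv g (\<phi> u) * deriv \<phi> u) (at u)"
      using assms(2,3) by (rule has_field_derivative_transform_within_open) (simp add: that(2))
    then show ?thesis by (rule DERIV_imp_deriv)
  qed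
  show "deriv \<sigma> u = deriv \<tau> (\<phi> u) * deriv \<phi> u" "deriv y u = deriv z (\<phi> u) * deriv \<phi> u"
    using * assms(4,5) reparam_into_unshearD[OF assms(1)] by blast+
qed

text \<open>By the mean value theorem, two equal values would force a zero of the derivative.\<close>

lemma reparam_into_inj_on:
  assumes "reparam_into \<phi> I Y K Z" "is_interval I"
  shows "inj_on \<phi> I"
proof (rule linorder_inj_onI)
  fix u v assume uv: "u < v" "u \<in> I" "v \<in> I"
  have d: "(\<phi> has_real_derivative deriv \<phi> w) (at w)" "deriv \<phi> w \<noteq> 0" if "u \<le> w" "w \<le> v" for w
  proof -
    have "w \<in> I" using assms(2) uv that unfolding is_interval_1 by blast
    then show "(\<phi> has_real_derivative deriv \<phi> w) (at w)" "deriv \<phi> w \<noteq> 0"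
      using assms(1) smooth_on_has_real_derivative unfolding reparam_into_def by blast+
  qed
  obtain w where w: "u < w" "w < v" "\<phi> v - \<phi> u = (v - u) * deriv \<phi> w"
    using MVT2[OF uv(1) d(1)] by blast
  then show "\<phi> u \<noteq> \<phi> v" using d(2)[of w] uv(1) by auto
qed auto

lemma sheared_solution_parabolic:
  assumes "sheared_solution I \<sigma> y" "\<And>u. u \<in> I \<Longrightarrow> deriv \<sigma> u = 0"
  shows "\<exists>C. reparam_into y I (unshear \<sigma> y) UNIV (parabola C)"
proof -
  have s: "is_interval I" "smooth_on I \<sigma>" "smooth_on I y" "\<And>u. u \<in> I \<Longrightarrow> deriv y u \<noteq> 0"
    using assms unfolding sheared_solution_def by auto
  have "(\<sigma> has_real_derivative 0) (at u within I)" if "u \<in> I" for u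
    using smooth_on_has_real_derivative[OF s(2) that] assms(2)[OF that]
    by (simp add: has_field_derivative_at_within)
  from has_field_derivative_zero_constant[OF is_interval_convex[OF s(1)] this]
  obtain C where "\<And>u. u \<in> I \<Longrightarrow> \<sigma> u = C" by blast
  then have "reparam_into y I (unshear \<sigma> y) UNIV (parabola C)"
    using s unfolding reparam_into_def parabola_eq_unshear by (auto simp: unshear_def)
  then show ?thesis ..
qed

text \<open>
  The slope \<open>t = q / a\<close> in the sheared plane satisfies \<open>t' = a (3 t^2 - 3 t + 1)\<close>, so it is a regular
  parameter, and with respect to it both coordinates have the derivatives of the joined curve.
\<close>

lemma sheared_solution_joined:
  assumes "sheared_solution I \<sigma> y" "\<And>u. u \<in> I \<Longrightarrow> deriv \<sigma> u \<noteq> 0"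
  shows "\<exists>C1 C2. reparam_into (\<lambda>u. deriv y u / deriv \<sigma> u) I (unshear \<sigma> y)
    UNIV (joined_curve C1 C2)"
proof -
  define a q t where "a = deriv \<sigma>" and "q = deriv y" and "t = (\<lambda>u. q u / a u)"
  let ?D = "\<lambda>t::real. 3 * t\<^sup>2 - 3 * t + 1"
  have I: "open I" "is_interval I" and s: "smooth_on I \<sigma>" "smooth_on I y"
    and eq: "\<And>u. u \<in> I \<Longrightarrow> a u * deriv q u - q u * deriv a u =
      a u * ((a u)\<^sup>2 - 3 * a u * q u + 3 * (q u)\<^sup>2)"
    using assms unfolding sheared_solution_def a_def q_def by auto
  have a0: "a u \<noteq> 0" if "u \<in> I" for u unfolding a_def using assms(2) that .
  note sm = s[THEN smooth_on_deriv, folded a_def q_def]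
  note d = smooth_on_has_real_derivative
  have st: "smooth_on I t" unfolding t_def by (rule smooth_on_divide[OF I(1) sm(2,1) a0])
  have dt: "(t has_real_derivative a u * ?D (t u)) (at u)" if "u \<in> I" for u
  proof -
    have "(t has_real_derivative (deriv q u * a u - q u * deriv a u) / (a u * a u)) (at u)"
      unfolding t_def using d[OF sm(2) that] d[OF sm(1) that] a0[OF that] by (rule DERIV_divide)
    also have "(deriv q u * a u - q u * deriv a u) / (a u * a u) = a u * ?D (t u)"
    proof -
      have "deriv q u * a u - q u * deriv a u = a u * ((a u)\<^sup>2 - 3 * a u * q u + 3 * (q u)\<^sup>2)"
        using eq[OF that] by (simp add: mult.commute)
      then show ?thesis using a0[OF that] by (simp add: t_def field_simps power2_eq_square)
    qed
    finally show ?thesis .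
  qed
  have D: "?D r \<noteq> 0" for r using height_argument_pos[of r] by simp
  \<comment> \<open>A function with the derivative \<open>a e(t)\<close> is, by \<open>t' = a D\<close>, an antiderivative of \<open>e / D\<close> in \<open>t\<close>.\<close>
  have const: "\<exists>c. \<forall>u\<in>I. f u = g (t u) + c"
    if "\<And>u. u \<in> I \<Longrightarrow> (f has_real_derivative a u * e (t u)) (at u)"
      "\<And>r. (g has_real_derivative e r / ?D r) (at r)" for f g e :: "real \<Rightarrow> real"
  proof -
    have "((\<lambda>u. f u - g (t u)) has_real_derivative 0) (at u within I)" if "u \<in> I" for u
      using DERIV_diff[OF \<open>\<And>u. u \<in> I \<Longrightarrow> (f has_real_derivative a u * e (t u)) (at u)\<close>[OF that]
          DERIV_chain2[OF \<open>\<And>r. (g has_real_derivative e r / ?D r) (at r)\<close> dt[OF that]]] D[of "t u"]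
      by (simp add: has_field_derivative_at_within)
    from has_field_derivative_zero_constant[OF is_interval_convex[OF I(2)] this]
    obtain c where "\<And>u. u \<in> I \<Longrightarrow> f u - g (t u) = c" by blast
    then have "\<forall>u\<in>I. f u = g (t u) + c" by (auto simp: algebra_simps)
    then show ?thesis ..
  qed
  obtain c where c: "\<forall>u\<in>I. \<sigma> u = 2 / sqrt 3 * turning (t u) + c"
    using const[of \<sigma> "\<lambda>_. 1" "\<lambda>r. 2 / sqrt 3 * turning r"] d[OF s(1)] turning_has_derivative
    by (auto simp: a_def)
  obtain C1 where C1: "\<forall>u\<in>I. y u = height (t u) + C1"
    using const[of y "\<lambda>r. r" height] d[OF s(2)] height_has_derivative a0
    by (auto simp: t_def q_def)
  \<comment> \<open>The second constant solves \<open>c = C2 - C1^2 / 2 + C1\<close>.\<close>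
  have "unshear \<sigma> y u = joined_curve C1 (c + C1\<^sup>2 / 2 - C1) (t u)" if "u \<in> I" for u
    unfolding joined_curve_closed_form using c C1 that by (simp add: unshear_def)
  moreover have "deriv t u \<noteq> 0" if "u \<in> I" for u
    using DERIV_imp_deriv[OF dt[OF that]] a0[OF that] D by simp
  ultimately have "reparam_into t I (unshear \<sigma> y) UNIV (joined_curve C1 (c + C1\<^sup>2 / 2 - C1))"
    using st unfolding reparam_into_def by auto
  then show ?thesis unfolding t_def q_def a_def by blast
qed

lemma solution_cases:
  assumes "solution I Y"
  obtains C \<phi> where "reparam_into \<phi> I Y UNIV (parabola C)"
  | C1 C2 \<phi> where "reparam_into \<phi> I Y UNIV (joined_curve C1 C2)"
  using assms
  by (metis solution_unshearE sheared_solution_dichotomy sheared_solution_parabolic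
      sheared_solution_joined)

text \<open>
  This turns into maximality when \<open>g\<close> is a quantity that is read off from the larger solution and
  recovers the parameter of the smaller curve: all values of \<open>g\<close> are then taken on the smaller curve.
\<close>

lemma image_eq_if_left_inverse:
  assumes "\<And>v. g (\<phi> v) = v" "inj_on g K" "range \<phi> \<subseteq> K"
  shows "range \<phi> = K"
proof
  show "K \<subseteq> range \<phi>"
  proof
    fix k assume "k \<in> K"
    then have "\<phi> (g k) = k"
      using assms by (intro inj_onD[OF assms(2)]) auto
    then show "k \<in> range \<phi>" by (metis rangeI)
  qed
qed fact

text \<open>
  One point with \<open>deriv \<tau> = 0\<close> suffices, by the dichotomy, to make the larger solution parabolic as a
  whole, so that its second coordinate is injective.
\<close>

lemma maximal_solution_parabola: "maximal_solution UNIV (parabola C)"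
  unfolding maximal_solution_def
proof (intro conjI allI impI solution_parabola)
  fix K Z \<phi>
  assume "solution K Z \<and> reparam_into \<phi> UNIV (parabola C) K Z"
  then obtain \<tau> z where ts: "sheared_solution K \<tau> z"
    and r: "reparam_into \<phi> UNIV (unshear (\<lambda>_. C) (\<lambda>v. v)) K (unshear \<tau> z)"
    unfolding parabola_eq_unshear by (metis solution_unshearE)
  have sm: "is_interval K" "smooth_on K \<tau>" "smooth_on K z"
    using ts unfolding sheared_solution_def by auto
  have "deriv \<tau> (\<phi> 0) = 0" "\<phi> 0 \<in> K"
    using reparam_into_derivs[OF r open_UNIV UNIV_I sm(2,3), of 0] by auto
  then have "\<And>k. k \<in> K \<Longrightarrow> deriv \<tau> k = 0"
    using sheared_solution_dichotomy[OF ts] by blast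
  then obtain C' where "reparam_into z K (unshear \<tau> z) UNIV (parabola C')"
    using sheared_solution_parabolic[OF ts] by blast
  then have "inj_on z K" using sm(1) by (rule reparam_into_inj_on)
  then show "range \<phi> = K"
    using r reparam_into_unshearD(2)[OF r]
    by (intro image_eq_if_left_inverse[of z]) (auto simp: reparam_into_def)
qed

text \<open>
  The slope \<open>deriv z / deriv \<tau>\<close> of the larger solution is invariant under reparametrization, hence
  equals \<open>t\<close> at the point with parameter \<open>t\<close> of the joined curve.
\<close>

lemma maximal_solution_joined_curve: "maximal_solution UNIV (joined_curve C1 C2)"
  unfolding maximal_solution_def
proof (intro conjI allI impI solution_joined_curve)
  fix K Z \<phi>
  let ?D = "\<lambda>t::real. 3 * t\<^sup>2 - 3 * t + 1"
  assume "solution K Z \<and> reparam_into \<phi> UNIV (joined_curve C1 C2) K Z"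
  then obtain \<tau> z where ts: "sheared_solution K \<tau> z"
    and r: "reparam_into \<phi> UNIV (unshear (\<lambda>t. 2 / sqrt 3 * turning t + (C2 - C1\<^sup>2 / 2 + C1))
      (\<lambda>t. height t + C1)) K (unshear \<tau> z)"
    unfolding joined_curve_closed_form by (metis solution_unshearE)
  have sm: "is_interval K" "smooth_on K \<tau>" "smooth_on K z"
    using ts unfolding sheared_solution_def by auto
  have d: "1 / ?D t = deriv \<tau> (\<phi> t) * deriv \<phi> t" "t / ?D t = deriv z (\<phi> t) * deriv \<phi> t"
    "\<phi> t \<in> K" "deriv \<phi> t \<noteq> 0" and D: "?D t \<noteq> 0" for t
    using reparam_into_derivs[OF r open_UNIV UNIV_I sm(2,3), of t] height_argument_pos[of t]
      joined_curve_sheared_derivatives[THEN DERIV_imp_deriv] by auto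
  have "deriv \<tau> (\<phi> 0) \<noteq> 0" using d(1)[of 0] by auto
  then have nz: "\<And>k. k \<in> K \<Longrightarrow> deriv \<tau> k \<noteq> 0"
    using sheared_solution_dichotomy[OF ts] d(3) by blast
  let ?t = "\<lambda>k. deriv z k / deriv \<tau> k"
  obtain C1' C2' where "reparam_into ?t K (unshear \<tau> z) UNIV (joined_curve C1' C2')"
    using sheared_solution_joined[OF ts nz] by blast
  then have "inj_on ?t K" using sm(1) by (rule reparam_into_inj_on)
  moreover have "?t (\<phi> t) = t" for t
  proof -
    have "?t (\<phi> t) = (t / ?D t) / (1 / ?D t)" unfolding d using d(4) by simp
    then show ?thesis using D by simp
  qed
  ultimately show "range \<phi> = K"
    using d(3) by (intro image_eq_if_left_inverse[of ?t]) auto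
qed

lemma maximal_solution_same_curve:
  assumes "maximal_solution I Y" "solution UNIV Z" "reparam_into \<phi> I Y UNIV Z"
  shows "same_curve I Y UNIV Z"
proof -
  have "\<phi> ` I = UNIV" using assms unfolding maximal_solution_def by blast
  moreover have "inj_on \<phi> I"
    using assms reparam_into_inj_on
    unfolding maximal_solution_def solution_def immersed_curve_def by blast
  ultimately show ?thesis using assms(3) unfolding same_curve_def bij_betw_def by blast
qed

theorem theorem3p7:
  shows "(\<forall>C. maximal_solution UNIV (parabola C)) \<and>
         (\<forall>C1 C2. maximal_solution UNIV (joined_curve C1 C2)) \<and>
         (\<forall>I Y. maximal_solution I Y \<longrightarrow>
            (\<exists>C. same_curve I Y UNIV (parabola C)) \<or>
            (\<exists>C1 C2. same_curve I Y UNIV (joined_curve C1 C2)))"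
proof (intro conjI allI impI maximal_solution_parabola maximal_solution_joined_curve)
  fix I Y assume Y: "maximal_solution I Y"
  then have "solution I Y" unfolding maximal_solution_def by blast
  then show "(\<exists>C. same_curve I Y UNIV (parabola C)) \<or>
      (\<exists>C1 C2. same_curve I Y UNIV (joined_curve C1 C2))"
    using Y solution_parabola solution_joined_curve maximal_solution_same_curve
    by (cases rule: solution_cases) blast+
qed

end
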